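(* Let $X$ be a finite set of $n$ objects and $f_q : X \to \mathbb{R}_{\ge 0}$ with $F = \sum_{x\in X} f_q(x) > 0$. Order the elements as $x_1,\dots,x_n$ by decreasing $f_q$ value (ties broken uniformly at random), and write $f_i = f_q(x_i)$. Assign each element independently a random level with $\Pr(\ell_i = \ell) = 2^{-\ell}$ for $\ell = 1,2,\dots$, where $\ell_i$ is the level of $x_i$. For an integer $k \ge 1$ define $C_{\ell,i} = \sum_{j=1}^{i} \mathbf{1}[\ell_j = \ell]$ (so $C_{\ell,0}=0$), $I_i = \mathbf{1}[C_{\ell_i, i-1} < k]$, $p_i = \sum_{\ell \ge 1 : C_{\ell,i-1} < k} 2^{-\ell}$, and the estimator $E = \sum_{i=1}^n \frac{I_i}{p_i} f_i$. Let $\ell^* = \lfloor \log_2(n/k) \rfloor$. For any $\delta \in (0,1)$ such that $k \ge 8 \log(3(\ell^*+3)/\delta)$, set $b = k - \left\lceil \sqrt{2k \log(3(\ell^*+3)/\delta)} \right\rceil$. Then, with probability at least $1-\delta$ (over the levels and tie-breaking), $$\frac{|E - F|}{F} \le \sqrt{\frac{3\log(3/\delta)}{4b}} + \frac{2\log(3/\delta)}{3b} = \mathcal{O}\!\left(\sqrt{\frac{\log(1/\delta)}{k}}\right).$$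
   Context: $\log$ is the natural logarithm. $I_i = 1$ exactly when $x_i$ is among the $k$ elements with largest $f_q$ value within its own level, so $E$ can be computed from the union of the per-level top-$k$ sets.
   Formalization: The final O-bound is proved uniformly for δ in (0, δ0], for every fixed δ0 < 1, and where ℓ*+3 > 0 so that the logarithm is defined; with one constant for all δ in (0,1) it fails as δ → 1, since log(1/δ) → 0 but log(3/δ) does not. *)

theory Defs
  imports "HOL-Probability.Probability" "HOL-Combinatorics.Multiset_Permutations"
    "HOL-Library.Landau_Symbols"
begin

section \<open>The random experiment\<close>

definition level_pmf :: "nat pmf" where
  "level_pmf = map_pmf Suc (geometric_pmf (1/2))"

lemma pmf_level_pmf: "pmf level_pmf l = (if l \<ge> 1 then 1 / 2 ^ l else 0)"
proof (cases l)
  case 0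
  then have "l \<notin> set_pmf level_pmf" by (auto simp: level_pmf_def)
  then show ?thesis using 0 by (simp add: set_pmf_eq)
next
  case (Suc m)
  then show ?thesis
    by (simp add: level_pmf_def pmf_map_inj' power_one_over)
qed

definition decreasing_orders :: "('a \<Rightarrow> real) \<Rightarrow> 'a set \<Rightarrow> 'a list set" where
  "decreasing_orders f X = {xs \<in> permutations_of_set X. sorted_wrt (\<lambda>x y. f x \<ge> f y) xs}"

text \<open>An outcome is a pair of an ordering of the objects and an assignment of levels. Breaking ties
  uniformly at random means that all decreasing orders are equally likely, independently of the
  levels. Levels of elements outside \<open>X\<close> are fixed to the dummy value 0.\<close>

definition sampling_pmf :: "('a \<Rightarrow> real) \<Rightarrow> 'a set \<Rightarrow> ('a list \<times> ('a \<Rightarrow> nat)) pmf" where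
  "sampling_pmf f X =
     pair_pmf (pmf_of_set (decreasing_orders f X)) (Pi_pmf X 0 (\<lambda>_. level_pmf))"

section \<open>The estimator\<close>

text \<open>Indices start at 1, whereas list positions start at 0.\<close>

definition elt :: "'a list \<Rightarrow> nat \<Rightarrow> 'a" where
  "elt xs i = xs ! (i - 1)"

definition level_count :: "'a list \<Rightarrow> ('a \<Rightarrow> nat) \<Rightarrow> nat \<Rightarrow> nat \<Rightarrow> nat" where
  "level_count xs lev l i = (\<Sum>j=1..i. of_bool (lev (elt xs j) = l))"

definition included :: "nat \<Rightarrow> 'a list \<Rightarrow> ('a \<Rightarrow> nat) \<Rightarrow> nat \<Rightarrow> real" where
  "included k xs lev i = of_bool (level_count xs lev (lev (elt xs i)) (i - 1) < k)"

definition incl_prob :: "nat \<Rightarrow> 'a list \<Rightarrow> ('a \<Rightarrow> nat) \<Rightarrow> nat \<Rightarrow> real" where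
  "incl_prob k xs lev i =
     (\<Sum>\<^sub>\<infinity>l\<in>{l. l \<ge> 1 \<and> level_count xs lev l (i - 1) < k}. 1 / 2 ^ l)"

definition estimator :: "nat \<Rightarrow> ('a \<Rightarrow> real) \<Rightarrow> 'a list \<Rightarrow> ('a \<Rightarrow> nat) \<Rightarrow> real" where
  "estimator k f xs lev =
     (\<Sum>i=1..length xs. included k xs lev i / incl_prob k xs lev i * f (elt xs i))"

section \<open>The error bound\<close>

definition ell_star :: "nat \<Rightarrow> nat \<Rightarrow> int" where
  "ell_star n k = \<lfloor>log 2 (real n / real k)\<rfloor>"

definition log_term :: "nat \<Rightarrow> nat \<Rightarrow> real \<Rightarrow> real" where
  "log_term n k \<delta> = ln (3 * (real_of_int (ell_star n k) + 3) / \<delta>)"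

definition b_param :: "nat \<Rightarrow> nat \<Rightarrow> real \<Rightarrow> int" where
  "b_param n k \<delta> = int k - \<lceil>sqrt (2 * real k * log_term n k \<delta>)\<rceil>"

definition error_bound :: "nat \<Rightarrow> nat \<Rightarrow> real \<Rightarrow> real" where
  "error_bound n k \<delta> =
     sqrt (3 * ln (3 / \<delta>) / (4 * real_of_int (b_param n k \<delta>)))
       + 2 * ln (3 / \<delta>) / (3 * real_of_int (b_param n k \<delta>))"

text \<open>The parameter region for the asymptotic claim. The cut-off \<open>\<delta> \<le> \<delta>0\<close> (for arbitrary
  \<open>\<delta>0 < 1\<close>) is needed because \<open>ln (1/\<delta>)\<close> tends to 0 as \<open>\<delta>\<close> tends to 1, whereas the error bound does
  not. For \<open>n < k\<close> the number \<open>ell_star n k\<close> is negative; the condition \<open>0 < ell_star n k + 3\<close> says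
  that the logarithm in \<open>log_term\<close> has a positive argument (recall that \<open>ln 0 = 0\<close> and
  \<open>ln (-x) = ln x\<close> in HOL).\<close>

definition param_region :: "real \<Rightarrow> (nat \<times> nat \<times> real) set" where
  "param_region \<delta>0 = {(n, k, \<delta>). n \<ge> 1 \<and> k \<ge> 1 \<and> 0 < \<delta> \<and> \<delta> \<le> \<delta>0 \<and>
     0 < ell_star n k + 3 \<and> real k \<ge> 8 * log_term n k \<delta>}"

end

(* Conditionally on the levels of the first i - 1 objects, I_i is a Bernoulli variable with mean p_i,
   so E - F is a sum of martingale differences f_i (I_i / p_i - 1) with conditional variances
   f_i^2 (1 / p_i - 1). A Chernoff bound shows that, outside an event of probability at most
   \<delta>/3, every level l holds fewer than k of the first b 2^l objects, which bounds 1 / p_i by the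
   largest power of two below i / b. Suppressing the differences that violate this bound makes the
   variance bound deterministic, so that Bernstein's moment generating function argument applies.
   The total variance is at most 3 F^2 / (8 b): as f_i decreases, the worst case is a constant
   initial segment. *)

theory Submission
  imports Defs
begin

section \<open>Exponential inequalities and sums over decreasing sequences\<close>

text \<open>The event that no level fills up early involves all levels at once, so conditioning on
  it would destroy the Bernoulli law of I_i given the past. Suppression avoids this, and on that
  event no difference is suppressed, so the suppressed sum is still E - F there. The decreasing
  order enters twice: it gives the variance bound, and through i f_i <= F it cancels the growth of 1
  / p_i, so that differences stay within F / b. Heavy objects at the front do no harm: for i <= 2 b
  a difference is kept only if p_i = 1, and then it is 0. Constants: with L = ln (3
  (\<open>ell_star\<close> + 3) / \<delta>), k - sqrt (2 k L) is an expected count for which the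
  probability of reaching k is still at most exp (- L), and b is this value rounded down. There are
  infinitely many levels, but \<open>ell_star\<close> + 3 events suffice: one for each level up to
  \<open>ell_star\<close> + 2 and one for all higher levels together. The other 2 \<delta> / 3 pays
  for the two Bernstein tails. The 3/4 under the root is twice the 3/8 of the variance.\<close>

lemma exp_le_quadratic:
  fixes x c :: real
  assumes "x \<le> c" "c < 3"
  shows "exp x \<le> 1 + x + x\<^sup>2 / (2 * (1 - c / 3))"
proof -
  \<comment> \<open>(x^2 + 4 x + 6) / (6 - 2 x) is the Pade approximant of \<open>exp\<close> at 0
    with degrees 2 and 1. With the denominator cleared, the difference \<open>h\<close> vanishes at
    0 together with its derivative, and it is convex because 1 - x <= exp (- x).\<close>
  define h where "h = (\<lambda>x::real. x\<^sup>2 + 4 * x + 6 - (6 - 2 * x) * exp x)"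
  define h' where "h' = (\<lambda>x::real. 2 * x + 4 - (4 - 2 * x) * exp x)"
  define h'' where "h'' = (\<lambda>x::real. 2 - (2 - 2 * x) * exp x)"
  have "convex_on UNIV h"
  proof (rule f''_ge0_imp_convex)
    show "(h has_real_derivative h' x) (at x)" for x
      unfolding h_def h'_def by (auto intro!: derivative_eq_intros simp: algebra_simps)
    show "(h' has_real_derivative h'' x) (at x)" for x
      unfolding h'_def h''_def by (auto intro!: derivative_eq_intros simp: algebra_simps)
    show "h'' x \<ge> 0" for x
    proof -
      have "(1 - x) * exp x \<le> exp (- x) * exp x"
        using exp_ge_add_one_self[of "- x"] by (intro mult_right_mono) auto
      then show ?thesis by (simp add: h''_def algebra_simps flip: exp_add)
    qed
  qed auto
  then have "h x - h 0 \<ge> h' 0 * (x - 0)"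
    by (rule convex_on_imp_above_tangent) (auto simp: h_def h'_def intro!: derivative_eq_intros)
  then have "(6 - 2 * x) * exp x \<le> x\<^sup>2 + 4 * x + 6"
    by (simp add: h_def h'_def)
  then have "exp x \<le> (x\<^sup>2 + 4 * x + 6) / (6 - 2 * x)"
    using assms by (simp add: field_simps)
  also have "\<dots> = 1 + x + x\<^sup>2 / (2 * (1 - x / 3))"
    using assms by (simp add: divide_simps) (simp add: algebra_simps power2_eq_square)
  also have "\<dots> \<le> 1 + x + x\<^sup>2 / (2 * (1 - c / 3))"
    using assms by (intro add_left_mono divide_left_mono mult_pos_pos) auto
  finally show ?thesis .
qed

lemma bernstein_coeff_nonneg: "z < 3 \<Longrightarrow> 0 \<le> x\<^sup>2 / (2 * (1 - z / 3))" for x z :: real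
  by simp

text \<open>The moment generating function of \<open>a * (I / p - 1)\<close> for a Bernoulli variable \<open>I\<close> with
  parameter \<open>p\<close>.\<close>

lemma bernoulli_mgf_le:
  fixes p a R t :: real
  assumes "0 < p" "p \<le> 1" "a * (1 / p - 1) \<le> R" "p < 1 \<Longrightarrow> a \<le> R" "0 \<le> a" "\<bar>t\<bar> * R < 3"
  shows "p * exp (t * (a * (1 / p - 1))) + (1 - p) * exp (t * - a)
    \<le> exp (t\<^sup>2 / (2 * (1 - \<bar>t\<bar> * R / 3)) * (a\<^sup>2 * (1 / p - 1)))"
proof -
  define c where "c = 2 * (1 - \<bar>t\<bar> * R / 3)"
  have "2 * (1 - z / 3) > 0" if "z < 3" for z :: real using that by simp
  then have c: "c > 0" using assms(6) unfolding c_def by blast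
  have le: "t * y \<le> \<bar>t\<bar> * R" if "\<bar>y\<bar> \<le> R" for y
    using abs_ge_self[of "t * y"] mult_left_mono[OF that, of "\<bar>t\<bar>"] by (simp add: abs_mult)
  have p: "1 / p - 1 \<ge> 0" using assms by simp
  then have "\<bar>a * (1 / p - 1)\<bar> \<le> R" using assms by (simp add: abs_mult)
  then have 1: "p * exp (t * (a * (1 / p - 1)))
      \<le> p * (1 + t * (a * (1 / p - 1)) + (t * (a * (1 / p - 1)))\<^sup>2 / c)"
    using le assms unfolding c_def by (intro mult_left_mono exp_le_quadratic[where c = "\<bar>t\<bar> * R"]) auto
  have 2: "(1 - p) * exp (t * - a) \<le> (1 - p) * (1 + t * - a + (t * - a)\<^sup>2 / c)"
  proof (cases "p < 1")
    case True
    then show ?thesis using le[of "- a"] assms unfolding c_def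
      by (intro mult_left_mono exp_le_quadratic[where c = "\<bar>t\<bar> * R"]) auto
  qed (use assms in auto)
  define w where "w = 1 / p - 1"
  have pw: "p * w = 1 - p" using assms(1) by (simp add: w_def field_simps)
  \<comment> \<open>The linear term is the mean of I / p - 1, which is p w - (1 - p) = 0. The
    quadratic term is its second moment, which collapses to w.\<close>
  have "p * (1 + t * (a * w) + (t * (a * w))\<^sup>2 / c) + (1 - p) * (1 + t * - a + (t * - a)\<^sup>2 / c)
      = 1 + t * a * (p * w - (1 - p)) + t\<^sup>2 / c * a\<^sup>2 * ((p * w) * w + (1 - p))"
    by (simp add: algebra_simps power2_eq_square add_divide_distrib diff_divide_distrib)
  also have "(p * w) * w + (1 - p) = w"
    by (subst pw) (use pw in \<open>simp add: algebra_simps\<close>)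
  finally have "p * (1 + t * (a * w) + (t * (a * w))\<^sup>2 / c)
      + (1 - p) * (1 + t * - a + (t * - a)\<^sup>2 / c) = 1 + t\<^sup>2 / c * (a\<^sup>2 * w)"
    using pw by simp
  then have "p * exp (t * (a * w)) + (1 - p) * exp (t * - a) \<le> 1 + t\<^sup>2 / c * (a\<^sup>2 * w)"
    using add_mono[OF 1 2] by (simp only: w_def)
  also have "\<dots> \<le> exp (t\<^sup>2 / c * (a\<^sup>2 * w))" by (rule exp_ge_add_one_self)
  finally show ?thesis by (simp only: c_def w_def)
qed

section \<open>Chernoff bound for counts under a product distribution\<close>

lemma ln_one_minus_le:
  fixes x :: real
  assumes "0 \<le> x" "x < 1"
  shows "ln (1 - x) \<le> - x - x\<^sup>2 / 2"
proof -
  define g where "g = (\<lambda>x::real. - x - x\<^sup>2 / 2 - ln (1 - x))"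
  have "g 0 \<le> g x"
  proof (rule DERIV_nonneg_imp_nondecreasing[OF assms(1)])
    fix y assume y: "0 \<le> y" "y \<le> x"
    have "(g has_real_derivative (1 / (1 - y) - 1 - y)) (at y)"
      unfolding g_def using y assms by (auto intro!: derivative_eq_intros)
    moreover have "1 / (1 - y) - 1 - y \<ge> 0"
      using y assms by (simp add: field_simps)
    ultimately show "\<exists>D. (g has_real_derivative D) (at y) \<and> 0 \<le> D" by blast
  qed
  then show ?thesis by (simp add: g_def)
qed

text \<open>The left-hand side is the multiplicative Chernoff exponent for a count of mean m to
  reach k. With x = 1 - m / k it equals k (x + ln (1 - x)) <= - k x^2 / 2, and k x >= sqrt (2 k L)
  turns this into - L.\<close>

lemma chernoff_exponent_le:
  fixes k m L :: real
  assumes "0 < m" "m \<le> k - sqrt (2 * k * L)" "0 \<le> L" "0 < k"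
  shows "k - m - k * ln (k / m) \<le> - L"
proof -
  define x where "x = 1 - m / k"
  have k0: "sqrt (2 * k * L) \<ge> 0" using assms by simp
  then have mk: "m \<le> k" using assms by linarith
  have x: "0 \<le> x" "x < 1" "k * x = k - m"
    using assms mk by (auto simp: x_def field_simps)
  have "2 * k * L = (sqrt (2 * k * L))\<^sup>2" using assms by simp
  also have "\<dots> \<le> (k * x)\<^sup>2"
    using x assms k0 by (intro power_mono) auto
  also have "\<dots> = 2 * k * (k * x\<^sup>2 / 2)" by (simp add: power2_eq_square)
  finally have "L \<le> k * x\<^sup>2 / 2" using assms by (simp only: mult_le_cancel_left_pos)
  moreover have "ln (k / m) = - ln (1 - x)"
    using assms by (simp add: x_def ln_div)
  moreover have "k * ln (1 - x) \<le> k * (- x - x\<^sup>2 / 2)"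
    using ln_one_minus_le[OF x(1,2)] assms by (intro mult_left_mono) auto
  ultimately show ?thesis using x(3) by (simp add: algebra_simps)
qed

lemma Pi_pmf_count_tail:
  fixes q :: "'b pmf" and k :: nat
  assumes "finite A" "T \<subseteq> A" "real (card T) * measure_pmf.prob q S \<le> m"
    and "0 < m" "m \<le> real k - sqrt (2 * real k * L)" "0 \<le> L" "0 < k"
  shows "measure_pmf.prob (Pi_pmf A d (\<lambda>_. q)) {y. k \<le> card {x \<in> T. y x \<in> S}} \<le> exp (- L)"
proof -
  \<comment> \<open>The optimal base for the exponential moment of the count: it minimises exp (m (r
    - 1)) / r^k.\<close>
  define r where "r = real k / m"
  \<comment> \<open>The power of \<open>r\<close> is written as a product over all of
    \<open>A\<close>, with factor 1 outside \<open>T\<close>, so that its expectation factors over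
    the independent coordinates.\<close>
  define g where "g = (\<lambda>x v. if x \<in> T \<and> v \<in> S then r else 1)"
  define h where "h = (\<lambda>y. \<Prod>x\<in>A. g x (y x))"
  let ?M = "Pi_pmf A d (\<lambda>_. q)"
  have "sqrt (2 * real k * L) \<ge> 0" using assms by simp
  then have "m \<le> real k" using assms by linarith
  then have r: "r \<ge> 1" using assms by (simp add: r_def)
  have g: "1 \<le> g x v" "g x v \<le> r" for x v using r by (auto simp: g_def)
  have h: "h y = r ^ card {x \<in> T. y x \<in> S}" for y
  proof -
    have "h y = (\<Prod>x\<in>A. if x \<in> {x \<in> T. y x \<in> S} then r else 1)" by (simp add: h_def g_def)
    also have "\<dots> = (\<Prod>x\<in>A \<inter> {x \<in> T. y x \<in> S}. r)"
      using assms(1) by (subst prod.inter_restrict[symmetric]) auto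
    also have "A \<inter> {x \<in> T. y x \<in> S} = {x \<in> T. y x \<in> S}" using assms(2) by auto
    finally show ?thesis by simp
  qed
  have "norm (h y) \<le> r ^ card A" for y
    unfolding h using r assms(1,2) by (auto intro!: power_increasing card_mono)
  then have int: "integrable ?M h"
    by (intro measure_pmf.integrable_const_bound[where B = "r ^ card A"]) auto
  have gE: "measure_pmf.expectation q (g x) = (if x \<in> T then 1 + measure_pmf.prob q S * (r - 1) else 1)" for x
  proof (cases "x \<in> T")
    case True
    have "measure_pmf.expectation q (g x) = measure_pmf.expectation q (\<lambda>v. 1 + indicator S v * (r - 1))"
      using True by (intro Bochner_Integration.integral_cong) (auto simp: g_def)
    also have "\<dots> = 1 + measure_pmf.prob q S * (r - 1)"
      by (subst Bochner_Integration.integral_add)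
        (auto intro!: integrable_mult_left integrable_real_indicator simp: measure_pmf.emeasure_eq_measure)
    finally show ?thesis using True by simp
  qed (simp add: g_def)
  have "measure_pmf.expectation ?M h = (\<Prod>x\<in>A. measure_pmf.expectation q (g x))"
    unfolding h_def
  proof (rule expectation_prod_Pi_pmf)
    show "integrable (measure_pmf q) (g x)" for x
    proof (intro measure_pmf.integrable_const_bound[where B = r] always_eventually allI)
      show "norm (g x v) \<le> r" for v using g[of x v] by simp
    qed simp
    show "0 \<le> g x v" for x v using g(1)[of x v] by linarith
  qed (rule assms(1))
  also have "\<dots> = (\<Prod>x\<in>A \<inter> T. 1 + measure_pmf.prob q S * (r - 1))"
    unfolding gE using assms(1) by (subst prod.inter_restrict) auto
  also have "\<dots> = (1 + measure_pmf.prob q S * (r - 1)) ^ card T"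
    using assms(2) by (simp add: Int_absorb1)
  also have "\<dots> \<le> exp (measure_pmf.prob q S * (r - 1)) ^ card T"
    using r by (intro power_mono) auto
  also have "\<dots> = exp (real (card T) * measure_pmf.prob q S * (r - 1))"
    by (subst exp_of_nat_mult[symmetric]) (simp add: mult.assoc)
  also have "\<dots> \<le> exp (m * (r - 1))"
    using assms(3) r by (intro exp_le_cancel_iff[THEN iffD2] mult_right_mono) auto
  also have "m * (r - 1) = k - m" using assms by (simp add: r_def field_simps)
  finally have E: "measure_pmf.expectation ?M h \<le> exp (real k - m)" .
  have "measure_pmf.prob ?M {y. k \<le> card {x \<in> T. y x \<in> S}} \<le> measure_pmf.prob ?M {y \<in> space ?M. h y \<ge> r ^ k}"
    unfolding h using r by (intro measure_pmf.finite_measure_mono) (auto intro: power_increasing)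
  also have "\<dots> \<le> measure_pmf.expectation ?M h / r ^ k"
    by (rule integral_Markov_inequality_measure[OF int, where A = "{}"]) (use r in \<open>auto simp: h\<close>)
  also have "\<dots> \<le> exp (real k - m) / r ^ k"
    using E r by (intro divide_right_mono) auto
  also have "\<dots> = exp (real k - m - real k * ln r)"
    using r by (subst exp_diff) (simp add: exp_of_nat_mult)
  also have "\<dots> \<le> exp (- L)"
    unfolding r_def exp_le_cancel_iff using assms by (intro chernoff_exponent_le) auto
  finally show ?thesis .
qed

section \<open>Sums against nonincreasing sequences\<close>

lemma weighted_sum_nonneg_if_antimono:
  fixes c w :: "nat \<Rightarrow> real"
  assumes "\<And>i. 1 \<le> i \<Longrightarrow> i < n \<Longrightarrow> c (Suc i) \<le> c i" "\<And>i. 1 \<le> i \<Longrightarrow> i \<le> n \<Longrightarrow> 0 \<le> c i"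
    and "\<And>m. m \<le> n \<Longrightarrow> 0 \<le> (\<Sum>i=1..m. w i)"
  shows "0 \<le> (\<Sum>i=1..n. c i * w i)"
proof -
  \<comment> \<open>Abel summation in inductive form: since the partial sum is nonnegative,
    replacing its factor \<open>c m\<close> by the smaller \<open>c (Suc m)\<close> only lowers the
    left-hand side.\<close>
  have "c m * (\<Sum>i=1..m. w i) \<le> (\<Sum>i=1..m. c i * w i)" if "1 \<le> m" "m \<le> n" for m
    using that
  proof (induction m rule: dec_induct)
    case (step m)
    have "c (Suc m) * (\<Sum>i=1..m. w i) \<le> c m * (\<Sum>i=1..m. w i)"
      using step assms by (intro mult_right_mono) auto
    then show ?case using step by (simp add: algebra_simps)
  qed simp
  from this[of n] show ?thesis
    using mult_nonneg_nonneg[OF assms(2)[of n] assms(3)[of n]] by (cases "n = 0") auto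
qed

lemma mult_le_sum_if_antimono:
  fixes a :: "nat \<Rightarrow> real"
  assumes "\<And>i. 1 \<le> i \<Longrightarrow> i < n \<Longrightarrow> a (Suc i) \<le> a i" "m \<le> n" "1 \<le> m"
  shows "real m * a m \<le> (\<Sum>i=1..m. a i)"
  using assms(3,2)
proof (induction m rule: dec_induct)
  case (step m)
  have "real m * a (Suc m) \<le> real m * a m" using step assms(1) by (intro mult_left_mono) auto
  also have "\<dots> \<le> (\<Sum>i=1..m. a i)" using step by simp
  finally show ?case using step by (simp add: algebra_simps)
qed simp

text \<open>A new term a raises the square of the sum S by 2 a S + a^2, and monotonicity gives S >=
  m a. Equality holds when the sequence is constant up to some index and 0 afterwards.\<close>

lemma sum_squares_odd_weight_le:
  fixes a :: "nat \<Rightarrow> real"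
  assumes "\<And>i. 1 \<le> i \<Longrightarrow> i < n \<Longrightarrow> a (Suc i) \<le> a i" "\<And>i. 1 \<le> i \<Longrightarrow> i \<le> n \<Longrightarrow> 0 \<le> a i" "m \<le> n"
  shows "(\<Sum>i=1..m. (a i)\<^sup>2 * (2 * real i - 1)) \<le> (\<Sum>i=1..m. a i)\<^sup>2"
  using assms(3)
proof (induction m)
  case (Suc m)
  let ?S = "\<Sum>i=1..m. a i"
  have "real (Suc m) * a (Suc m) \<le> (\<Sum>i=1..Suc m. a i)"
    using Suc assms by (intro mult_le_sum_if_antimono[of n]) auto
  then have "real m * a (Suc m) \<le> ?S" by (simp add: algebra_simps)
  then have "a (Suc m) * (real m * a (Suc m)) \<le> a (Suc m) * ?S"
    using assms(2)[of "Suc m"] Suc by (intro mult_left_mono) auto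
  moreover have "(\<Sum>i=1..Suc m. a i)\<^sup>2 = ?S\<^sup>2 + 2 * (a (Suc m) * ?S) + (a (Suc m))\<^sup>2"
    by (simp add: power2_eq_square algebra_simps)
  moreover have "(\<Sum>i=1..Suc m. (a i)\<^sup>2 * (2 * real i - 1))
      = (\<Sum>i=1..m. (a i)\<^sup>2 * (2 * real i - 1)) + 2 * (a (Suc m) * (real m * a (Suc m))) + (a (Suc m))\<^sup>2"
    by (simp add: power2_eq_square algebra_simps)
  ultimately show ?case using Suc by linarith
qed simp

text \<open>The extremal nonincreasing sequences of given sum are constant on an initial segment.\<close>

lemma sum_squares_weight_le:
  fixes a g :: "nat \<Rightarrow> real" and c :: real
  assumes a: "\<And>i. 1 \<le> i \<Longrightarrow> i < n \<Longrightarrow> a (Suc i) \<le> a i" "\<And>i. 1 \<le> i \<Longrightarrow> i \<le> n \<Longrightarrow> 0 \<le> a i"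
    and g: "\<And>m. m \<le> n \<Longrightarrow> (\<Sum>i=1..m. g i) \<le> c * (real m)\<^sup>2" and "0 \<le> c"
  shows "(\<Sum>i=1..n. (a i)\<^sup>2 * g i) \<le> c * (\<Sum>i=1..n. a i)\<^sup>2"
proof -
  \<comment> \<open>The odd numbers are the increments of m^2, so the hypothesis on \<open>g\<close>
    says that the weights c (2 i - 1) - g i have nonnegative partial sums. Abel summation then
    applies with the nonincreasing squares as coefficients.\<close>
  have odd: "(\<Sum>i=1..m. 2 * real i - 1) = (real m)\<^sup>2" for m :: nat
    by (induction m) (auto simp: power2_eq_square algebra_simps)
  have "0 \<le> (\<Sum>i=1..n. (a i)\<^sup>2 * (c * (2 * real i - 1) - g i))"
  proof (rule weighted_sum_nonneg_if_antimono)
    show "(a (Suc i))\<^sup>2 \<le> (a i)\<^sup>2" if "1 \<le> i" "i < n" for i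
      using that a by (intro power_mono) auto
    show "0 \<le> (\<Sum>i=1..m. c * (2 * real i - 1) - g i)" if "m \<le> n" for m
      using g[OF that] by (simp only: sum_subtractf[of "\<lambda>i. c * (2 * real i - 1)"] odd flip: sum_distrib_left)
  qed simp
  also have "\<dots> = c * (\<Sum>i=1..n. (a i)\<^sup>2 * (2 * real i - 1)) - (\<Sum>i=1..n. (a i)\<^sup>2 * g i)"
    unfolding sum_distrib_left sum_subtractf[symmetric] by (intro sum.cong) (auto simp: algebra_simps)
  finally have "(\<Sum>i=1..n. (a i)\<^sup>2 * g i) \<le> c * (\<Sum>i=1..n. (a i)\<^sup>2 * (2 * real i - 1))"
    by simp
  also have "\<dots> \<le> c * (\<Sum>i=1..n. a i)\<^sup>2"
    using a \<open>0 \<le> c\<close> by (intro mult_left_mono sum_squares_odd_weight_le[of n]) auto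
  finally show ?thesis .
qed

section \<open>The bound on inverse inclusion probabilities\<close>

text \<open>\<open>dyadic_step b i\<close> bounds the inverse inclusion probability of the \<open>i\<close>-th object when every level
  \<open>l \<ge> 1\<close> holds fewer than \<open>k\<close> of the first \<open>b * 2 ^ l\<close> objects.\<close>

definition dyadic_exp :: "nat \<Rightarrow> nat \<Rightarrow> nat" where
  "dyadic_exp b i = (LEAST j. i \<le> b * 2 ^ Suc j)"

definition dyadic_step :: "nat \<Rightarrow> nat \<Rightarrow> real" where
  "dyadic_step b i = 2 ^ dyadic_exp b i"

lemma dyadic_step_ge_1: "1 \<le> dyadic_step b i"
  by (simp add: dyadic_step_def)

lemma le_dyadic_exp:
  assumes "0 < b"
  shows "i \<le> b * 2 ^ Suc (dyadic_exp b i)"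
  unfolding dyadic_exp_def
proof (rule LeastI)
  have "i \<le> 1 * 2 ^ Suc i" using less_exp[of "Suc i"] by linarith
  also have "\<dots> \<le> b * 2 ^ Suc i" using assms by (intro mult_right_mono) auto
  finally show "i \<le> b * 2 ^ Suc i" .
qed

lemma less_dyadic_exp:
  assumes "dyadic_exp b i \<noteq> 0"
  shows "b * 2 ^ dyadic_exp b i < i"
proof -
  obtain j where j: "dyadic_exp b i = Suc j" using assms not0_implies_Suc by blast
  then have "\<not> i \<le> b * 2 ^ Suc j"
    using not_less_Least[of j "\<lambda>j. i \<le> b * 2 ^ Suc j"] by (simp add: dyadic_exp_def)
  then show ?thesis by (simp add: j)
qed

text \<open>Combined with i f_i <= F this yields the range F / b of the suppressed differences. The
  restriction excludes the initial block, where the step is 1 although i may be at most b.\<close>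

lemma mult_dyadic_step_less:
  assumes "1 < dyadic_step b i"
  shows "real b * dyadic_step b i < real i"
proof -
  have "dyadic_exp b i \<noteq> 0" using assms by (intro notI) (simp add: dyadic_step_def)
  then have "real (b * 2 ^ dyadic_exp b i) < real i" using less_dyadic_exp by (simp only: of_nat_less_iff)
  then show ?thesis by (simp add: dyadic_step_def)
qed

lemma dyadic_exp_0 [simp]: "dyadic_exp b 0 = 0"
  by (simp add: dyadic_exp_def)

text \<open>Drives the induction for the sum of the steps: the step either stays or doubles, and it
  doubles only at a known breakpoint.\<close>

lemma dyadic_exp_Suc:
  assumes "0 < b"
  shows "dyadic_exp b (Suc m) = dyadic_exp b m \<or>
    dyadic_exp b (Suc m) = Suc (dyadic_exp b m) \<and> m = b * 2 ^ Suc (dyadic_exp b m)"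
proof -
  let ?j = "dyadic_exp b m"
  have le: "m \<le> b * 2 ^ Suc ?j" by (rule le_dyadic_exp[OF assms])
  have ge: "?j \<le> j" if "Suc m \<le> b * 2 ^ Suc j" for j
    using that unfolding dyadic_exp_def by (intro Least_le) simp
  show ?thesis
  proof (cases "Suc m \<le> b * 2 ^ Suc ?j")
    case True
    then have "dyadic_exp b (Suc m) = ?j"
      unfolding dyadic_exp_def[of b "Suc m"] using ge by (intro Least_equality) auto
    then show ?thesis ..
  next
    case False
    then have m: "m = b * 2 ^ Suc ?j" using le by simp
    have "dyadic_exp b (Suc m) = Suc ?j"
      unfolding dyadic_exp_def[of b "Suc m"]
    proof (rule Least_equality)
      have "Suc m \<le> m + m" using m assms by (cases m) auto
      also have "m + m = b * 2 ^ Suc (Suc ?j)" by (subst (1 2) m) simp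
      finally show "Suc m \<le> b * 2 ^ Suc (Suc ?j)" .
      show "Suc ?j \<le> j" if "Suc m \<le> b * 2 ^ Suc j" for j
        using ge[OF that] that False by (cases "j = ?j") auto
    qed
    then show ?thesis using m by blast
  qed
qed

text \<open>\<open>m \<mapsto> m * (s - 1) - 2 / 3 * b * (s\<^sup>2 - 1)\<close> for \<open>s\<close> a power of two is the linear piece of the
  left-hand side between \<open>b * s\<close> and \<open>2 * b * s\<close>.\<close>

lemma sum_dyadic_step_le_linear:
  assumes "0 < b"
  shows "(\<Sum>i=1..m. dyadic_step b i - 1)
    \<le> real m * (dyadic_step b m - 1) - 2 / 3 * real b * ((dyadic_step b m)\<^sup>2 - 1)"
proof (induction m)
  case 0
  then show ?case by (simp add: dyadic_step_def)
next
  case (Suc m)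
  let ?s = "dyadic_step b m"
  consider "dyadic_step b (Suc m) = ?s" | "dyadic_step b (Suc m) = 2 * ?s" "real m = 2 * real b * ?s"
    using dyadic_exp_Suc[OF assms, of m]
  proof (elim disjE conjE)
    assume "dyadic_exp b (Suc m) = Suc (dyadic_exp b m)" and m: "m = b * 2 ^ Suc (dyadic_exp b m)"
    then have "dyadic_step b (Suc m) = 2 * ?s" by (simp add: dyadic_step_def)
    moreover have "real m = 2 * real b * ?s" by (subst m) (simp add: dyadic_step_def)
    ultimately show ?thesis using that by blast
  qed (use that in \<open>simp add: dyadic_step_def\<close>)
  then show ?case
  proof cases
    case 1
    then show ?thesis using Suc by (simp add: algebra_simps)
  next
    case 2
    \<comment> \<open>At the breakpoint m = 2 b s the linear pieces for s and 2 s take the same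
      value, so the change of piece loses nothing.\<close>
    have "(\<Sum>i=1..Suc m. dyadic_step b i - 1)
        \<le> real m * (?s - 1) - 2 / 3 * real b * (?s\<^sup>2 - 1) + (2 * ?s - 1)"
      using Suc 2 by simp
    also have "\<dots> = real (Suc m) * (2 * ?s - 1) - 2 / 3 * real b * ((2 * ?s)\<^sup>2 - 1)"
      using 2(2) by (simp add: field_simps power2_eq_square)
    finally show ?thesis using 2 by simp
  qed
qed

lemma sum_dyadic_step_le:
  assumes "0 < b"
  shows "(\<Sum>i=1..m. dyadic_step b i - 1) \<le> 3 / (8 * real b) * (real m)\<^sup>2"
proof -
  let ?s = "dyadic_step b m"
  \<comment> \<open>Completing the square in m. The square vanishes at m = 4 b (s - 1) / 3; for s >=
    4 this lies in the range from b s to 2 b s where s is the current step, and the remaining term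
    has lower order, so 3/8 cannot be improved for large s.\<close>
  have "0 \<le> ((3 * real m - 4 * real b * (?s - 1))\<^sup>2 + 32 * (real b)\<^sup>2 * (?s - 1)) / (24 * real b)"
    using dyadic_step_ge_1[of b m] by (intro divide_nonneg_nonneg add_nonneg_nonneg mult_nonneg_nonneg) auto
  also have "\<dots> = 3 / (8 * real b) * (real m)\<^sup>2
      - (real m * (?s - 1) - 2 / 3 * real b * (?s\<^sup>2 - 1))"
    using assms by (simp add: divide_simps) (simp add: algebra_simps power2_eq_square)
  finally show ?thesis using sum_dyadic_step_le_linear[OF assms, of m] by linarith
qed

section \<open>The level distribution and inclusion probabilities\<close>

lemma prob_level_pmf_ge: "measure_pmf.prob level_pmf {Suc j..} = 1 / 2 ^ j"
proof -
  have "measure_pmf.prob level_pmf {..j} = (\<Sum>l\<le>j. pmf level_pmf l)"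
    by (simp add: measure_measure_pmf_finite)
  also have "\<dots> = 1 - 1 / 2 ^ j"
    by (induction j) (auto simp: pmf_level_pmf)
  finally have "measure_pmf.prob level_pmf {..j} = 1 - 1 / 2 ^ j" .
  moreover have "{Suc j..} = space level_pmf - {..j}" by auto
  ultimately show ?thesis by (subst \<open>{Suc j..} = _\<close>, subst measure_pmf.prob_compl) auto
qed

lemma prob_level_pmf_singleton_le: "measure_pmf.prob level_pmf {l} \<le> 1 / 2 ^ l"
  by (simp add: measure_pmf_single pmf_level_pmf)

lemma incl_prob_eq:
  "incl_prob k xs lev i = measure_pmf.prob level_pmf {l. level_count xs lev l (i - 1) < k}"
proof -
  let ?A = "{l. level_count xs lev l (i - 1) < k}"
  have "measure_pmf.prob level_pmf ?A = infsum (pmf level_pmf) ?A"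
    unfolding measure_pmf_conv_infsetsum by (rule infsetsum_infsum) (rule pmf_abs_summable)
  also have "\<dots> = incl_prob k xs lev i"
    unfolding incl_prob_def by (rule infsum_cong_neutral) (auto simp: pmf_level_pmf)
  finally show ?thesis ..
qed

lemma nn_integral_pmf_if:
  fixes u v :: real
  assumes "0 \<le> u" "0 \<le> v"
  shows "(\<integral>\<^sup>+x. ennreal (if x \<in> S then u else v) \<partial>measure_pmf q)
    = ennreal (measure_pmf.prob q S * u + (1 - measure_pmf.prob q S) * v)"
proof -
  have int: "integrable (measure_pmf q) (\<lambda>x. indicator A x * c)" for A and c :: real
    by (auto intro!: integrable_mult_left integrable_real_indicator simp: measure_pmf.emeasure_eq_measure)
  have "(\<integral>\<^sup>+x. ennreal (if x \<in> S then u else v) \<partial>measure_pmf q)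
      = (\<integral>\<^sup>+x. ennreal (indicator S x * u + indicator (- S) x * v) \<partial>measure_pmf q)"
    by (intro nn_integral_cong) auto
  also have "\<dots> = ennreal (measure_pmf.expectation q (\<lambda>x. indicator S x * u + indicator (- S) x * v))"
    using int assms by (intro nn_integral_eq_integral Bochner_Integration.integrable_add) auto
  also have "measure_pmf.expectation q (\<lambda>x. indicator S x * u + indicator (- S) x * v)
      = measure_pmf.prob q S * u + measure_pmf.prob q (- S) * v"
    by (subst Bochner_Integration.integral_add[OF int int]) simp
  also have "measure_pmf.prob q (- S) = 1 - measure_pmf.prob q S"
    using measure_pmf.prob_compl[of S q] by (simp add: Compl_eq_Diff_UNIV)
  finally show ?thesis .
qed

section \<open>Concentration of the clipped errors\<close>

lemma elt_append_left [simp]: "1 \<le> j \<Longrightarrow> j \<le> length ys \<Longrightarrow> elt (ys @ zs) j = elt ys j"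
  by (auto simp: elt_def nth_append)

lemma elt_append_Suc [simp]: "elt (ys @ [x]) (Suc (length ys)) = x"
  by (simp add: elt_def)

lemma elt_in_set: "1 \<le> j \<Longrightarrow> j \<le> length ys \<Longrightarrow> elt ys j \<in> set ys"
  by (simp add: elt_def)

lemma level_count_snoc:
  assumes "x \<notin> set ys" "i \<le> length ys"
  shows "level_count (ys @ [x]) (lev(x := v)) l i = level_count ys lev l i"
  unfolding level_count_def
proof (intro sum.cong refl)
  fix j assume j: "j \<in> {1..i}"
  then have "elt ys j \<in> set ys" using assms(2) by (intro elt_in_set) auto
  then have "elt ys j \<noteq> x" using assms(1) by blast
  then show "of_bool ((lev(x := v)) (elt (ys @ [x]) j) = l) = (of_bool (lev (elt ys j) = l) :: nat)"
    using j assms(2) by simp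
qed

text \<open>Predictability: the index may be that of the new object \<open>x\<close> itself, since
  p_i counts only objects before the i-th. For \<open>included\<close> the index has to stay within
  \<open>ys\<close>.\<close>

lemma incl_prob_snoc:
  assumes "x \<notin> set ys" "i \<le> Suc (length ys)"
  shows "incl_prob k (ys @ [x]) (lev(x := v)) i = incl_prob k ys lev i"
  using assms by (simp add: incl_prob_eq level_count_snoc)

lemma included_snoc:
  assumes "x \<notin> set ys" "1 \<le> i" "i \<le> length ys"
  shows "included k (ys @ [x]) (lev(x := v)) i = included k ys lev i"
proof -
  have "elt ys i \<noteq> x" using assms elt_in_set by metis
  then show ?thesis using assms by (simp add: included_def level_count_snoc)
qed

text \<open>The error contributed by the \<open>i\<close>-th object, suppressed when its inclusion probability is
  below \<open>1 / u i\<close>. Since this condition only depends on the levels of the preceding objects, the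
  suppressed errors still form a martingale difference sequence.\<close>

definition clipped_error ::
    "(nat \<Rightarrow> real) \<Rightarrow> nat \<Rightarrow> ('a \<Rightarrow> real) \<Rightarrow> 'a list \<Rightarrow> ('a \<Rightarrow> nat) \<Rightarrow> nat \<Rightarrow> real" where
  "clipped_error u k f xs lev i =
     (if 1 \<le> incl_prob k xs lev i * u i
      then f (elt xs i) * (included k xs lev i / incl_prob k xs lev i - 1) else 0)"

lemma clipped_error_snoc:
  assumes "x \<notin> set ys" "1 \<le> i" "i \<le> length ys"
  shows "clipped_error u k f (ys @ [x]) (lev(x := v)) i = clipped_error u k f ys lev i"
  using assms by (simp add: clipped_error_def incl_prob_snoc included_snoc)

text \<open>Conditional exponential moment of the last difference, given the levels
  \<open>lev\<close> of the objects in \<open>ys\<close>, which determine both p and whether the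
  difference is suppressed. If it is, the integrand is 1; otherwise the Bernoulli estimate applies,
  with 1 / p bounded by \<open>u\<close>. When \<open>u\<close> is 1, a kept difference has p = 1
  and is 0, so \<open>f x\<close> may then exceed \<open>R\<close>.\<close>

lemma clipped_error_step:
  fixes u :: "nat \<Rightarrow> real" and R t :: real
  defines "c \<equiv> t\<^sup>2 / (2 * (1 - \<bar>t\<bar> * R / 3))"
  assumes "x \<notin> set ys" "0 \<le> f x" "1 \<le> u (Suc (length ys))"
    and "f x * (u (Suc (length ys)) - 1) \<le> R" "1 < u (Suc (length ys)) \<Longrightarrow> f x \<le> R" "\<bar>t\<bar> * R < 3"
  shows "(\<integral>\<^sup>+v. ennreal (exp (t * clipped_error u k f (ys @ [x]) (lev(x := v)) (Suc (length ys)))) \<partial>level_pmf)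
    \<le> ennreal (exp (c * ((f x)\<^sup>2 * (u (Suc (length ys)) - 1))))"
proof -
  let ?i = "Suc (length ys)"
  define p where "p = incl_prob k ys lev ?i"
  define S where "S = {l. level_count ys lev l (length ys) < k}"
  have p: "p = measure_pmf.prob level_pmf S" by (simp add: p_def S_def incl_prob_eq)
  have p01: "0 \<le> p" "p \<le> 1" by (simp_all add: p)
  have ce: "clipped_error u k f (ys @ [x]) (lev(x := v)) ?i
      = (if 1 \<le> p * u ?i then f x * ((if v \<in> S then 1 else 0) / p - 1) else 0)" for v
    using assms(2) by (simp add: clipped_error_def incl_prob_snoc included_def level_count_snoc S_def p_def)
  have "0 \<le> R"
  proof (cases "1 < u ?i")
    case True
    then show ?thesis using assms by linarith
  qed (use assms in auto)
  have c: "0 \<le> c" unfolding c_def by (rule bernstein_coeff_nonneg[OF assms(7)])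
  show ?thesis
  proof (cases "1 \<le> p * u ?i")
    case False
    then have "(\<integral>\<^sup>+v. ennreal (exp (t * clipped_error u k f (ys @ [x]) (lev(x := v)) ?i)) \<partial>level_pmf) = 1"
      by (simp add: ce)
    also have "\<dots> \<le> ennreal (exp (c * ((f x)\<^sup>2 * (u ?i - 1))))"
      using c assms(4) by simp
    finally show ?thesis .
  next
    case True
    then have "p \<noteq> 0" by auto
    then have p0: "0 < p" using p01 by simp
    have pu: "1 / p \<le> u ?i" using True p0 by (simp add: field_simps)
    have le: "f x * (1 / p - 1) \<le> f x * (u ?i - 1)" using assms(3) pu by (intro mult_left_mono) auto
    have "(\<integral>\<^sup>+v. ennreal (exp (t * clipped_error u k f (ys @ [x]) (lev(x := v)) ?i)) \<partial>level_pmf)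
        = (\<integral>\<^sup>+v. ennreal (if v \<in> S then exp (t * (f x * (1 / p - 1))) else exp (t * - f x)) \<partial>level_pmf)"
      using True by (intro nn_integral_cong) (simp add: ce)
    also have "\<dots> = ennreal (p * exp (t * (f x * (1 / p - 1))) + (1 - p) * exp (t * - f x))"
      by (simp add: nn_integral_pmf_if p)
    also have "\<dots> \<le> ennreal (exp (c * ((f x)\<^sup>2 * (1 / p - 1))))"
      unfolding c_def
    proof (intro ennreal_leI bernoulli_mgf_le)
      show "f x \<le> R" if "p < 1"
      proof (rule assms(6))
        have "1 < 1 / p" using that p0 by simp
        then show "1 < u ?i" using pu by linarith
      qed
    qed (use p0 p01 le assms in \<open>auto intro: order_trans\<close>)
    also have "\<dots> \<le> ennreal (exp (c * ((f x)\<^sup>2 * (u ?i - 1))))"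
      using c pu by (intro ennreal_leI exp_le_cancel_iff[THEN iffD2] mult_left_mono) auto
    finally show ?thesis .
  qed
qed

text \<open>The tower property as an induction from the end of the list: the level of the last
  object is integrated first, with all earlier levels fixed, and contributes a deterministic factor.
  Nonnegative integrals leave no integrability to check. Both signs of \<open>t\<close> are covered,
  for the two tails.\<close>

lemma clipped_error_mgf:
  fixes u :: "nat \<Rightarrow> real" and R t :: real
  defines "c \<equiv> t\<^sup>2 / (2 * (1 - \<bar>t\<bar> * R / 3))"
  assumes "distinct xs" "\<And>x. x \<in> set xs \<Longrightarrow> 0 \<le> f x" "\<And>i. 1 \<le> u i" "\<bar>t\<bar> * R < 3"
    and "\<And>i. 1 \<le> i \<Longrightarrow> i \<le> length xs \<Longrightarrow> f (elt xs i) * (u i - 1) \<le> R"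
    and "\<And>i. 1 \<le> i \<Longrightarrow> i \<le> length xs \<Longrightarrow> 1 < u i \<Longrightarrow> f (elt xs i) \<le> R"
  shows "(\<integral>\<^sup>+lev. ennreal (exp (t * (\<Sum>i=1..length xs. clipped_error u k f xs lev i)))
      \<partial>Pi_pmf (set xs) 0 (\<lambda>_. level_pmf))
    \<le> ennreal (exp (c * (\<Sum>i=1..length xs. (f (elt xs i))\<^sup>2 * (u i - 1))))"
  using assms(2,3,6,7)
proof (induction xs rule: rev_induct)
  case Nil
  then show ?case by simp
next
  case (snoc x ys)
  let ?n = "length ys"
  let ?P = "Pi_pmf (set ys) 0 (\<lambda>_. level_pmf)"
  let ?e = "\<lambda>lev. \<Sum>i=1..?n. clipped_error u k f ys lev i"
  let ?V = "\<Sum>i=1..?n. (f (elt ys i))\<^sup>2 * (u i - 1)"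
  have x: "x \<notin> set ys" using snoc.prems by simp
  have IH: "(\<integral>\<^sup>+lev. ennreal (exp (t * ?e lev)) \<partial>?P) \<le> ennreal (exp (c * ?V))"
  proof (rule snoc.IH)
    fix i assume i: "1 \<le> i" "i \<le> ?n"
    show "f (elt ys i) * (u i - 1) \<le> R" using snoc.prems(3)[of i] i by simp
    show "f (elt ys i) \<le> R" if "1 < u i" using snoc.prems(4)[of i] i that by simp
  qed (use snoc.prems in auto)
  have sum: "(\<Sum>i=1..length (ys @ [x]). clipped_error u k f (ys @ [x]) (lev(x := v)) i)
      = ?e lev + clipped_error u k f (ys @ [x]) (lev(x := v)) (Suc ?n)" for lev v
    using x by (simp add: clipped_error_snoc)
  have step: "(\<integral>\<^sup>+v. ennreal (exp (t * clipped_error u k f (ys @ [x]) (lev(x := v)) (Suc ?n))) \<partial>level_pmf)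
    \<le> ennreal (exp (c * ((f x)\<^sup>2 * (u (Suc ?n) - 1))))" for lev
    unfolding c_def using snoc.prems(2-4) snoc.prems(3,4)[of "Suc ?n"] assms(4,5) x
    by (intro clipped_error_step) auto
  have "(\<integral>\<^sup>+lev. ennreal (exp (t * (\<Sum>i=1..length (ys @ [x]). clipped_error u k f (ys @ [x]) lev i)))
      \<partial>Pi_pmf (set (ys @ [x])) 0 (\<lambda>_. level_pmf))
    = (\<integral>\<^sup>+lev. \<integral>\<^sup>+v. ennreal (exp (t * (\<Sum>i=1..length (ys @ [x]). clipped_error u k f (ys @ [x]) (lev(x := v)) i)))
      \<partial>level_pmf \<partial>?P)"
    using x by (simp add: Pi_pmf_insert pair_commute_pmf[of level_pmf] nn_integral_pair_pmf' del: length_append)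
  also have "\<dots> = (\<integral>\<^sup>+lev. ennreal (exp (t * ?e lev)) *
      (\<integral>\<^sup>+v. ennreal (exp (t * clipped_error u k f (ys @ [x]) (lev(x := v)) (Suc ?n))) \<partial>level_pmf) \<partial>?P)"
    unfolding sum distrib_left exp_add by (simp add: ennreal_mult nn_integral_cmult)
  also have "\<dots> \<le> (\<integral>\<^sup>+lev. ennreal (exp (t * ?e lev)) *
      ennreal (exp (c * ((f x)\<^sup>2 * (u (Suc ?n) - 1)))) \<partial>?P)"
    using step by (intro nn_integral_mono mult_left_mono) auto
  also have "\<dots> = (\<integral>\<^sup>+lev. ennreal (exp (t * ?e lev)) \<partial>?P) * ennreal (exp (c * ((f x)\<^sup>2 * (u (Suc ?n) - 1))))"
    by (rule nn_integral_multc) simp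
  also have "\<dots> \<le> ennreal (exp (c * ?V)) * ennreal (exp (c * ((f x)\<^sup>2 * (u (Suc ?n) - 1))))"
    using IH by (intro mult_right_mono) auto
  also have "\<dots> = ennreal (exp (c * (\<Sum>i=1..length (ys @ [x]). (f (elt (ys @ [x]) i))\<^sup>2 * (u i - 1))))"
    by (simp add: distrib_left exp_add flip: ennreal_mult)
  finally show ?case .
qed

text \<open>\<open>t\<close> is the usual Bernstein choice. With D = V + R d / 3 it gives 1 - t R /
  3 = V / D, so the exponent becomes - d^2 / (2 D). The value of \<open>d\<close> ensures d^2 >= 2 L
  D: writing d = s + 2 R L / 3 with s^2 = 2 V L, one has 2 L D = s^2 + (2 R L / 3) d, and s <=
  d.\<close>

lemma bernstein_exponent:
  fixes V R L t d :: real
  assumes "0 < V" "0 \<le> R" "0 \<le> L"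
  defines "d \<equiv> sqrt (2 * V * L) + 2 * R * L / 3"
  defines "t \<equiv> d / (V + R * d / 3)"
  shows "0 \<le> t" "t * R < 3" "t\<^sup>2 / (2 * (1 - t * R / 3)) * V - t * d \<le> - L"
proof -
  have d: "0 \<le> d" using assms(1-3) by (simp add: d_def)
  define D where "D = V + R * d / 3"
  have D: "0 < D" using d assms(1,2) by (simp add: D_def add_pos_nonneg)
  have t: "t = d / D" by (simp add: t_def D_def)
  show "0 \<le> t" using d D by (simp add: t)
  have e: "1 - t * R / 3 = V / D" using D by (simp add: t field_simps D_def)
  then have "0 < 1 - t * R / 3" using D assms(1) by simp
  then show "t * R < 3" by linarith
  have "t\<^sup>2 / (2 * (1 - t * R / 3)) * V = d\<^sup>2 / (2 * D)"
    by (subst e, subst (1) t) (use D assms(1) in \<open>simp add: field_simps power2_eq_square\<close>)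
  moreover have "t * d = d\<^sup>2 / D" by (simp add: t power2_eq_square)
  moreover have "d\<^sup>2 / (2 * D) - d\<^sup>2 / D = - (d\<^sup>2 / (2 * D))"
    using D by (simp add: field_simps)
  moreover have "L \<le> d\<^sup>2 / (2 * D)"
  proof -
    define s where "s = sqrt (2 * V * L)"
    have s: "0 \<le> s" "s\<^sup>2 = 2 * V * L" using assms(1,3) by (auto simp: s_def)
    have ds: "d = s + 2 * R * L / 3" by (simp add: d_def s_def)
    have "L * (2 * D) = s\<^sup>2 + (2 * R * L / 3) * d" by (simp add: D_def s algebra_simps)
    also have "\<dots> \<le> s * d + (2 * R * L / 3) * d"
      unfolding power2_eq_square[of s] using s(1) assms(2,3)
      by (intro add_right_mono mult_left_mono) (simp_all add: ds)
    also have "\<dots> = d\<^sup>2" by (subst (3) ds) (simp add: power2_eq_square ds algebra_simps)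
    finally show ?thesis using D by (simp add: field_simps)
  qed
  ultimately show "t\<^sup>2 / (2 * (1 - t * R / 3)) * V - t * d \<le> - L" by linarith
qed

lemma clipped_error_tail:
  fixes u :: "nat \<Rightarrow> real" and R V L :: real
  defines "d \<equiv> sqrt (2 * V * L) + 2 * R * L / 3"
  assumes "distinct xs" "\<And>x. x \<in> set xs \<Longrightarrow> 0 \<le> f x" "\<And>i. 1 \<le> u i" "0 < V" "0 \<le> R" "0 \<le> L"
    and "\<And>i. 1 \<le> i \<Longrightarrow> i \<le> length xs \<Longrightarrow> f (elt xs i) * (u i - 1) \<le> R"
    and "\<And>i. 1 \<le> i \<Longrightarrow> i \<le> length xs \<Longrightarrow> 1 < u i \<Longrightarrow> f (elt xs i) \<le> R"
    and "(\<Sum>i=1..length xs. (f (elt xs i))\<^sup>2 * (u i - 1)) \<le> V"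
  shows "measure_pmf.prob (Pi_pmf (set xs) 0 (\<lambda>_. level_pmf))
    {lev. d < \<bar>\<Sum>i=1..length xs. clipped_error u k f xs lev i\<bar>} \<le> 2 * exp (- L)"
proof -
  let ?M = "Pi_pmf (set xs) 0 (\<lambda>_. level_pmf)"
  let ?e = "\<lambda>lev. \<Sum>i=1..length xs. clipped_error u k f xs lev i"
  define t where "t = d / (V + R * d / 3)"
  have t: "0 \<le> t" "t * R < 3" "t\<^sup>2 / (2 * (1 - t * R / 3)) * V - t * d \<le> - L"
    using bernstein_exponent[of V R L] assms unfolding t_def d_def by auto
  have c: "0 \<le> t\<^sup>2 / (2 * (1 - t * R / 3))" by (rule bernstein_coeff_nonneg[OF t(2)])
  have exp_mult: "ennreal (exp x) * ennreal (exp y) = ennreal (exp (y + x))" for x y :: real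
    by (simp add: exp_add mult.commute flip: ennreal_mult)
  have tail: "measure_pmf.prob ?M {lev. d \<le> s * ?e lev} \<le> exp (- L)" if s: "s = 1 \<or> s = -1" for s :: real
  proof -
    \<comment> \<open>The exponential moment is taken at \<open>t * s\<close>; its bound depends
      only on the absolute value, so both tails get the same exponent.\<close>
    have ts: "\<bar>t * s\<bar> = t" "(t * s)\<^sup>2 = t\<^sup>2" using s t(1) by (auto simp: abs_mult power_mult_distrib)
    \<comment> \<open>Markov's inequality in pointwise form.\<close>
    have ind: "indicator {lev. d \<le> s * ?e lev} lev
        \<le> ennreal (exp (- t * d)) * ennreal (exp (t * s * ?e lev))" for lev
    proof (cases "d \<le> s * ?e lev")
      case True
      then have "t * d \<le> t * (s * ?e lev)" using t(1) by (rule mult_left_mono)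
      then have "1 \<le> exp (- t * d + t * s * ?e lev)" by (simp add: mult.assoc)
      also have "\<dots> = exp (- t * d) * exp (t * s * ?e lev)" by (rule exp_add)
      finally show ?thesis using True by (simp flip: ennreal_mult)
    qed simp
    have "emeasure ?M {lev. d \<le> s * ?e lev} = (\<integral>\<^sup>+lev. indicator {lev. d \<le> s * ?e lev} lev \<partial>?M)"
      by simp
    also have "\<dots> \<le> (\<integral>\<^sup>+lev. ennreal (exp (- t * d)) * ennreal (exp (t * s * ?e lev)) \<partial>?M)"
      by (intro nn_integral_mono ind)
    also have "\<dots> = ennreal (exp (- t * d)) * (\<integral>\<^sup>+lev. ennreal (exp (t * s * ?e lev)) \<partial>?M)"
      by (rule nn_integral_cmult) simp
    also have "\<dots> \<le> ennreal (exp (- t * d)) * ennreal (exp (t\<^sup>2 / (2 * (1 - t * R / 3)) *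
        (\<Sum>i=1..length xs. (f (elt xs i))\<^sup>2 * (u i - 1))))"
      using clipped_error_mgf[of xs f u "t * s" R k] assms t ts by (intro mult_left_mono) auto
    also have "\<dots> \<le> ennreal (exp (- t * d)) * ennreal (exp (t\<^sup>2 / (2 * (1 - t * R / 3)) * V))"
      using c assms by (intro mult_left_mono ennreal_leI exp_le_cancel_iff[THEN iffD2]) auto
    also have "\<dots> = ennreal (exp (t\<^sup>2 / (2 * (1 - t * R / 3)) * V - t * d))"
      by (subst exp_mult) simp
    also have "\<dots> \<le> ennreal (exp (- L))"
      using t(3) by (intro ennreal_leI exp_le_cancel_iff[THEN iffD2])
    finally show ?thesis by (simp add: measure_pmf.emeasure_eq_measure)
  qed
  have "measure_pmf.prob ?M {lev. d < \<bar>?e lev\<bar>}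
      \<le> measure_pmf.prob ?M ({lev. d \<le> 1 * ?e lev} \<union> {lev. d \<le> -1 * ?e lev})"
    by (intro measure_pmf.finite_measure_mono) auto
  also have "\<dots> \<le> measure_pmf.prob ?M {lev. d \<le> 1 * ?e lev} + measure_pmf.prob ?M {lev. d \<le> -1 * ?e lev}"
    by (intro measure_Un_le) auto
  also have "\<dots> \<le> 2 * exp (- L)" using tail[of 1] tail[of "-1"] by linarith
  finally show ?thesis .
qed

section \<open>The error of the estimator\<close>

lemma sum_elt:
  assumes "distinct xs" "i \<le> length xs"
  shows "(\<Sum>j=1..i. g (elt xs j)) = (\<Sum>x\<in>set (take i xs). g x)"
proof -
  have "bij_betw ((!) (take i xs)) {..<i} (set (take i xs))"
    using assms by (intro bij_betw_nth) auto
  then have "(\<Sum>x\<in>set (take i xs). g x) = (\<Sum>j<i. g (take i xs ! j))"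
    by (rule sum.reindex_bij_betw[symmetric])
  also have "\<dots> = (\<Sum>j=1..i. g (elt xs j))"
    unfolding elt_def by (rule sum.reindex_bij_witness[of _ "\<lambda>j. j - 1" Suc]) auto
  finally show ?thesis ..
qed

lemma level_count_eq_card:
  assumes "distinct xs" "i \<le> length xs"
  shows "level_count xs lev l i = card {x \<in> set (take i xs). lev x = l}"
  unfolding level_count_def sum_elt[OF assms, of "\<lambda>x. of_bool (lev x = l)"]
  by (simp add: of_bool_def sum.If_cases Int_def)

lemma level_count_le: "level_count xs lev l i \<le> i"
proof -
  have "level_count xs lev l i \<le> (\<Sum>j=1..i. 1)"
    unfolding level_count_def by (intro sum_mono) simp
  then show ?thesis by simp
qed

text \<open>For j = \<open>dyadic_exp b i\<close>, no level above j is full before the i-th object: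
  up to \<open>K\<close> because i <= b 2^l, and beyond \<open>K\<close> because all those levels
  together hold fewer than k objects. The levels above j have total mass 2^(-j), the inverse of the
  step.\<close>

lemma incl_prob_dyadic_step_ge_1:
  assumes "distinct xs" "0 < b" "1 \<le> i" "i \<le> length xs"
    and few: "\<And>l. l \<in> {1..K} \<Longrightarrow> card {x \<in> set (take (b * 2 ^ l) xs). lev x = l} < k"
    and "card {x \<in> set xs. lev x \<in> {Suc K..}} < k"
  shows "1 \<le> incl_prob k xs lev i * dyadic_step b i"
proof -
  let ?j = "dyadic_exp b i"
  have "level_count xs lev l (i - 1) < k" if l: "Suc ?j \<le> l" for l
  proof (cases "l \<le> K")
    case True
    have "i \<le> b * 2 ^ Suc ?j" by (rule le_dyadic_exp[OF assms(2)])
    also have "\<dots> \<le> b * 2 ^ l" using l by (intro mult_left_mono power_increasing) auto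
    finally have "set (take (i - 1) xs) \<subseteq> set (take (b * 2 ^ l) xs)"
      by (intro set_take_subset_set_take) simp
    then have "card {x \<in> set (take (i - 1) xs). lev x = l} \<le> card {x \<in> set (take (b * 2 ^ l) xs). lev x = l}"
      by (intro card_mono) auto
    also have "\<dots> < k" using few[of l] l True by simp
    finally show ?thesis using assms by (simp add: level_count_eq_card)
  next
    case False
    have "card {x \<in> set (take (i - 1) xs). lev x = l} \<le> card {x \<in> set xs. lev x \<in> {Suc K..}}"
      using False by (intro card_mono) (auto dest: in_set_takeD)
    then show ?thesis using assms by (simp add: level_count_eq_card)
  qed
  then have "measure_pmf.prob level_pmf {Suc ?j..} \<le> incl_prob k xs lev i"
    unfolding incl_prob_eq by (intro measure_pmf.finite_measure_mono) auto
  then have "1 / 2 ^ ?j \<le> incl_prob k xs lev i" by (simp only: prob_level_pmf_ge)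
  then show ?thesis by (simp add: dyadic_step_def field_simps)
qed

text \<open>Union bound over \<open>K\<close> + 1 Chernoff events. Among the first b 2^l objects, at
  most b are expected on level l; among all objects, n / 2^K are expected above level
  \<open>K\<close>. Both means are at most \<open>m\<close>.\<close>

lemma prob_incl_prob_small:
  fixes b k K :: nat and L :: real
  defines "m \<equiv> real k - sqrt (2 * real k * L)"
  assumes "distinct xs" "0 < b" "real b \<le> m" "0 \<le> L" "0 < k" "real (length xs) / 2 ^ K \<le> m"
  shows "measure_pmf.prob (Pi_pmf (set xs) 0 (\<lambda>_. level_pmf))
    {lev. \<exists>i\<in>{1..length xs}. \<not> 1 \<le> incl_prob k xs lev i * dyadic_step b i} \<le> real (Suc K) * exp (- L)"
proof -
  let ?M = "Pi_pmf (set xs) 0 (\<lambda>_. level_pmf)"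
  let ?B = "\<lambda>l. {lev. k \<le> card {x \<in> set (take (b * 2 ^ l) xs). lev x \<in> {l}}}"
  let ?C = "{lev. k \<le> card {x \<in> set xs. lev x \<in> {Suc K..}}}"
  have m: "0 < m" using assms by linarith
  have B: "measure_pmf.prob ?M (?B l) \<le> exp (- L)" for l
  proof (rule Pi_pmf_count_tail)
    have "card (set (take (b * 2 ^ l) xs)) \<le> b * 2 ^ l"
      using card_length[of "take (b * 2 ^ l) xs"] by simp
    then have "real (card (set (take (b * 2 ^ l) xs))) \<le> real (b * 2 ^ l)" by (simp only: of_nat_le_iff)
    then have "real (card (set (take (b * 2 ^ l) xs))) * measure_pmf.prob level_pmf {l}
        \<le> real (b * 2 ^ l) * (1 / 2 ^ l)"
      by (intro mult_mono prob_level_pmf_singleton_le) auto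
    then show "real (card (set (take (b * 2 ^ l) xs))) * measure_pmf.prob level_pmf {l} \<le> m"
      using assms by simp
  qed (use assms m in \<open>auto dest: in_set_takeD\<close>)
  have C: "measure_pmf.prob ?M ?C \<le> exp (- L)"
    by (rule Pi_pmf_count_tail[where m = m])
      (use assms m in \<open>auto simp: prob_level_pmf_ge distinct_card\<close>)
  have "{lev. \<exists>i\<in>{1..length xs}. \<not> 1 \<le> incl_prob k xs lev i * dyadic_step b i} \<subseteq> (\<Union>l\<in>{1..K}. ?B l) \<union> ?C"
  proof
    fix lev assume "lev \<in> {lev. \<exists>i\<in>{1..length xs}. \<not> 1 \<le> incl_prob k xs lev i * dyadic_step b i}"
    then obtain i where i: "1 \<le> i" "i \<le> length xs" "\<not> 1 \<le> incl_prob k xs lev i * dyadic_step b i" by auto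
    show "lev \<in> (\<Union>l\<in>{1..K}. ?B l) \<union> ?C"
    proof (rule ccontr)
      assume "lev \<notin> (\<Union>l\<in>{1..K}. ?B l) \<union> ?C"
      then have "1 \<le> incl_prob k xs lev i * dyadic_step b i"
        using assms(2,3) i(1,2) by (intro incl_prob_dyadic_step_ge_1[where K = K]) (auto simp: not_le)
      with i(3) show False ..
    qed
  qed
  then have "measure_pmf.prob ?M {lev. \<exists>i\<in>{1..length xs}. \<not> 1 \<le> incl_prob k xs lev i * dyadic_step b i}
      \<le> measure_pmf.prob ?M ((\<Union>l\<in>{1..K}. ?B l) \<union> ?C)"
    by (intro measure_pmf.finite_measure_mono) auto
  also have "\<dots> \<le> measure_pmf.prob ?M (\<Union>l\<in>{1..K}. ?B l) + measure_pmf.prob ?M ?C"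
    by (intro measure_Un_le) auto
  also have "\<dots> \<le> (\<Sum>l\<in>{1..K}. measure_pmf.prob ?M (?B l)) + measure_pmf.prob ?M ?C"
    by (intro add_right_mono measure_UNION_le) auto
  also have "\<dots> \<le> (\<Sum>l\<in>{1..K}. exp (- L)) + exp (- L)"
    by (intro add_mono sum_mono B C)
  finally show ?thesis by (simp add: algebra_simps)
qed

lemma b_param_bounds:
  assumes "8 * log_term n k \<delta> \<le> real k"
  shows "sqrt (2 * real k * log_term n k \<delta>) \<le> real k / 2"
    and "real_of_int (b_param n k \<delta>) \<le> real k - sqrt (2 * real k * log_term n k \<delta>)"
    and "real k / 2 - 1 < real_of_int (b_param n k \<delta>)"
proof -
  \<comment> \<open>The constant 8 of the hypothesis is exactly what 2 k L <= (k / 2)^2 requires.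
    Rounding the root up costs less than 1.\<close>
  have "real k * (8 * log_term n k \<delta>) \<le> real k * real k" using assms by (intro mult_left_mono) auto
  then show 1: "sqrt (2 * real k * log_term n k \<delta>) \<le> real k / 2"
    by (intro real_le_lsqrt) (auto simp: power2_eq_square)
  show "real_of_int (b_param n k \<delta>) \<le> real k - sqrt (2 * real k * log_term n k \<delta>)"
    and "real k / 2 - 1 < real_of_int (b_param n k \<delta>)"
    using 1 unfolding b_param_def by linarith+
qed

text \<open>Serves the case n <= k, where \<open>ell_star\<close> may be so negative that
  \<open>log_term\<close> does not bound ln (3 / \<delta>). For k = 1 only b > - 1/2 is known, so
  integrality is what gives b >= 0; if b = 0, division by 0 makes the bound 0.\<close>

lemma error_bound_nonneg:
  assumes "8 * log_term n k \<delta> \<le> real k" "1 \<le> k" "0 < \<delta>" "\<delta> < 1"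
  shows "0 \<le> error_bound n k \<delta>"
proof -
  have "-1 < real_of_int (b_param n k \<delta>)" using b_param_bounds(3)[OF assms(1)] assms(2) by linarith
  then have "0 \<le> b_param n k \<delta>" by linarith
  moreover have "0 \<le> ln (3 / \<delta>)" using assms by simp
  ultimately show ?thesis unfolding error_bound_def by simp
qed

lemma ln_le_log_term:
  assumes "0 < ell_star n k + 3" "0 < \<delta>"
  shows "ln (3 / \<delta>) \<le> log_term n k \<delta>"
proof -
  have "3 * 1 / \<delta> \<le> 3 * (real_of_int (ell_star n k) + 3) / \<delta>"
    using assms by (intro divide_right_mono mult_left_mono) linarith+
  then show ?thesis unfolding log_term_def using assms by (intro ln_mono) auto
qed

lemma ln_three_div_ge_1:
  assumes "0 < \<delta>" "\<delta> < 1"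
  shows "1 \<le> ln (3 / \<delta> :: real)"
proof -
  have "exp 1 \<le> 3 / \<delta>" using exp_le divide_left_mono[of \<delta> 1 3] assms by simp
  then show ?thesis using assms by (simp add: ln_ge_iff)
qed

lemma error_bound_bigo:
  assumes "0 < \<delta>0" "\<delta>0 < 1"
  shows "(\<lambda>(n, k, \<delta>). error_bound n k \<delta>)
    \<in> O[principal (param_region \<delta>0)](\<lambda>(n, k, \<delta>). sqrt (ln (1 / \<delta>) / real k))"
proof -
  \<comment> \<open>Chosen so that ln (3 / \<delta>) <= c ln (1 / \<delta>) whenever \<delta> <=
    \<delta>0: the summand ln 3 is absorbed because ln (1 / \<delta>) stays away from 0.\<close>
  define c where "c = 1 + ln 3 / ln (1 / \<delta>0)"
  have l0: "0 < ln (1 / \<delta>0)" using assms by simp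
  have c: "1 \<le> c" using l0 by (simp add: c_def)
  have bound: "\<bar>error_bound n k \<delta>\<bar> \<le> 3 * sqrt c * \<bar>sqrt (ln (1 / \<delta>) / real k)\<bar>"
    if "(n, k, \<delta>) \<in> param_region \<delta>0" for n k \<delta>
  proof -
    have *: "1 \<le> k" "0 < \<delta>" "\<delta> \<le> \<delta>0" "0 < ell_star n k + 3" "8 * log_term n k \<delta> \<le> real k"
      using that by (auto simp: param_region_def)
    define \<Lambda> where "\<Lambda> = ln (3 / \<delta>)"
    define y where "y = \<Lambda> / real k"
    define b where "b = real_of_int (b_param n k \<delta>)"
    have L1: "1 \<le> \<Lambda>" unfolding \<Lambda>_def using * assms by (intro ln_three_div_ge_1) auto
    have kL: "8 * \<Lambda> \<le> real k" using ln_le_log_term[OF *(4,2)] *(5) by (simp add: \<Lambda>_def)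
    \<comment> \<open>Since \<Lambda> >= 1, the hypothesis gives k >= 8, hence k / 2 - 1 >= k /
      4.\<close>
    have b: "real k / 4 \<le> b" "0 < b" using b_param_bounds(3)[OF *(5)] kL L1 unfolding b_def by linarith+
    have y: "0 \<le> y" "y \<le> 1 / 8" using L1 kL *(1) by (auto simp: y_def field_simps)
    have "\<Lambda> / b \<le> \<Lambda> / (real k / 4)" using b L1 *(1) by (intro divide_left_mono) auto
    then have Lb: "\<Lambda> / b \<le> 4 * y" by (simp add: y_def mult.commute)
    have "sqrt (3 * \<Lambda> / (4 * b)) \<le> sqrt (2\<^sup>2 * y)" using Lb y by (intro real_sqrt_le_mono) simp
    then have s1: "sqrt (3 * \<Lambda> / (4 * b)) \<le> 2 * sqrt y" by (simp add: real_sqrt_mult)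
    \<comment> \<open>Since y <= 1/8 <= 9/64, the linear term, at most 8 y / 3, is dominated by sqrt
      y. Together with 2 sqrt y from the root term this explains the factor 3.\<close>
    have "sqrt y \<le> sqrt ((3 / 8)\<^sup>2)" using y by (intro real_sqrt_le_mono) (simp add: power2_eq_square)
    then have "sqrt y * sqrt y \<le> sqrt y * (3 / 8)" using y by (intro mult_left_mono) auto
    then have "8 / 3 * y \<le> sqrt y" using y by simp
    then have s2: "2 * \<Lambda> / (3 * b) \<le> sqrt y" using Lb by simp
    have l1: "ln (1 / \<delta>0) \<le> ln (1 / \<delta>)" using * assms by (intro ln_mono) (auto simp: field_simps)
    have "ln 3 = ln 3 / ln (1 / \<delta>0) * ln (1 / \<delta>0)" using l0 by simp
    also have "\<dots> \<le> ln 3 / ln (1 / \<delta>0) * ln (1 / \<delta>)" using l0 l1 by (intro mult_left_mono) auto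
    finally have "\<Lambda> \<le> c * ln (1 / \<delta>)"
      using *(2) by (simp add: \<Lambda>_def c_def ln_div algebra_simps)
    then have "y \<le> c * (ln (1 / \<delta>) / real k)" using *(1) by (simp add: y_def divide_right_mono)
    then have "sqrt y \<le> sqrt c * sqrt (ln (1 / \<delta>) / real k)"
      using real_sqrt_le_mono by (metis real_sqrt_mult)
    moreover have "error_bound n k \<delta> \<le> 3 * sqrt y"
      using s1 s2 by (simp add: error_bound_def \<Lambda>_def b_def)
    moreover have "0 \<le> error_bound n k \<delta>" using * assms by (intro error_bound_nonneg) auto
    moreover have "0 \<le> sqrt (ln (1 / \<delta>) / real k)" using l0 l1 by simp
    ultimately show ?thesis by simp
  qed
  show ?thesis
    by (rule bigoI[where c = "3 * sqrt c"]) (use bound in \<open>auto simp: eventually_principal\<close>)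
qed

section \<open>Reduction to a fixed order, and conclusion\<close>

lemma estimator_eq_sum_if_length_le:
  assumes "length xs \<le> k"
  shows "estimator k f xs lev = (\<Sum>i=1..length xs. f (elt xs i))"
  unfolding estimator_def
proof (intro sum.cong refl)
  fix i assume i: "i \<in> {1..length xs}"
  have lt: "level_count xs lev l (i - 1) < k" for l
    using level_count_le[of xs lev l "i - 1"] i assms by auto
  then have "incl_prob k xs lev i = 1" by (simp add: incl_prob_eq)
  then show "included k xs lev i / incl_prob k xs lev i * f (elt xs i) = f (elt xs i)"
    using lt by (simp add: included_def)
qed

text \<open>Removes the random tie-breaking: a bound that holds for each decreasing order separately
  survives averaging over the orders.\<close>

lemma prob_pair_pmf_ge:
  fixes c :: real
  assumes "\<And>x. x \<in> set_pmf p \<Longrightarrow> c \<le> measure_pmf.prob q {y. Q x y}"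
  shows "c \<le> measure_pmf.prob (pair_pmf p q) {(x, y). Q x y}"
proof -
  have "ennreal c = (\<integral>\<^sup>+x. ennreal c \<partial>measure_pmf p)" by simp
  also have "\<dots> \<le> (\<integral>\<^sup>+x. emeasure (measure_pmf q) {y. Q x y} \<partial>measure_pmf p)"
    using assms by (intro nn_integral_mono_AE) (auto simp: AE_measure_pmf_iff measure_pmf.emeasure_eq_measure ennreal_leI)
  also have "\<dots> = (\<integral>\<^sup>+x. \<integral>\<^sup>+y. indicator {(x, y). Q x y} (x, y) \<partial>measure_pmf q \<partial>measure_pmf p)"
    by (intro nn_integral_cong) (simp add: indicator_def flip: nn_integral_indicator)
  also have "\<dots> = emeasure (measure_pmf (pair_pmf p q)) {(x, y). Q x y}"
    by (simp flip: nn_integral_pair_pmf')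
  finally show ?thesis by (simp add: measure_pmf.emeasure_eq_measure)
qed

text \<open>Needed because \<open>pmf_of_set\<close> has the intended support only for nonempty
  finite sets.\<close>

lemma decreasing_orders_nonempty:
  assumes "finite X"
  shows "decreasing_orders f X \<noteq> {}"
proof -
  obtain ys where "set ys = X" "distinct ys" using finite_distinct_list[OF assms] by blast
  then have "sort_key (\<lambda>x. - f x) ys \<in> decreasing_orders f X"
    using sorted_sort_key[of "\<lambda>x. - f x" ys]
    by (simp add: decreasing_orders_def permutations_of_set_def sorted_wrt_map)
  then show ?thesis by blast
qed

theorem theorem3p2:
  fixes X :: "'a set" and f :: "'a \<Rightarrow> real" and F \<delta> :: real and n k :: nat
  assumes "finite X" and "card X = n"
    and "\<And>x. x \<in> X \<Longrightarrow> f x \<ge> 0"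
    and "F = (\<Sum>x\<in>X. f x)" and "F > 0"
    and "k \<ge> 1"
    and "0 < \<delta>" and "\<delta> < 1"
    and "real k \<ge> 8 * log_term n k \<delta>"
  shows "measure_pmf.prob (sampling_pmf f X)
           {(xs, lev). \<bar>estimator k f xs lev - F\<bar> / F \<le> error_bound n k \<delta>} \<ge> 1 - \<delta>
         \<and> (\<forall>\<delta>0. 0 < \<delta>0 \<and> \<delta>0 < 1 \<longrightarrow>
              (\<lambda>(n', k', \<delta>'). error_bound n' k' \<delta>')
                \<in> O[principal (param_region \<delta>0)](\<lambda>(n', k', \<delta>'). sqrt (ln (1 / \<delta>') / real k')))"
proof (intro conjI allI impI)
  have "finite (decreasing_orders f X)" by (simp add: decreasing_orders_def)
  note set_orders = set_pmf_of_set[OF decreasing_orders_nonempty[OF assms(1)] this]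
  show "1 - \<delta> \<le> measure_pmf.prob (sampling_pmf f X)
      {(xs, lev). \<bar>estimator k f xs lev - F\<bar> / F \<le> error_bound n k \<delta>}"
    unfolding sampling_pmf_def
  proof (rule prob_pair_pmf_ge)
    fix xs assume "xs \<in> set_pmf (pmf_of_set (decreasing_orders f X))"
    then have "xs \<in> decreasing_orders f X" by (simp only: set_orders)
    then have xs: "set xs = X" "distinct xs" "sorted_wrt (\<lambda>x y. f x \<ge> f y) xs"
      by (auto simp: decreasing_orders_def permutations_of_set_def)
    have len: "length xs = n" using xs assms(2) distinct_card by fastforce
    have F: "F = (\<Sum>i=1..n. f (elt xs i))"
      using sum_elt[OF xs(2), of n f] len xs(1) assms(4) by simp
    have f: "0 \<le> f x" if "x \<in> set xs" for x using that assms(3) xs(1) by blast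
    note \<delta> = assms(7,8)
    have "1 - \<delta> \<le> measure_pmf.prob (Pi_pmf (set xs) 0 (\<lambda>_. level_pmf))
        {lev. \<bar>estimator k f xs lev - F\<bar> / F \<le> error_bound n k \<delta>}"
    proof (cases "n \<le> k")
      \<comment> \<open>No level can be full before any object, so the estimator is exact and only
        the sign of the bound matters.\<close>
      case True
      then have "{lev. \<bar>estimator k f xs lev - F\<bar> / F \<le> error_bound n k \<delta>} = UNIV"
        using len error_bound_nonneg[OF assms(9,6-8)] by (simp add: estimator_eq_sum_if_length_le F)
      then show ?thesis using assms(7) by simp
    next
      case False
      then have k: "1 \<le> k" "k < n" "8 * log_term n k \<delta> \<le> real k" using assms(6,9) by auto
      let ?M = "Pi_pmf (set xs) 0 (\<lambda>_. level_pmf)"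
      define L where "L = log_term n k \<delta>"
      define \<Lambda> where "\<Lambda> = ln (3 / \<delta>)"
      define b where "b = nat (b_param n k \<delta>)"
      \<comment> \<open>With this choice \<open>Suc K\<close> is \<open>ell_star\<close> + 3, the
        factor inside the logarithm, and n / k < 2^(\<open>ell_star\<close> + 1) = 2^K / 2 bounds
        the expected number of objects above level \<open>K\<close> by k / 2.\<close>
      define K where "K = nat (ell_star n k + 2)"
      define a where "a = (\<lambda>i. f (elt xs i))"
      \<comment> \<open>\<open>R\<close> and \<open>V\<close> are the range and variance parameters
        of the Bernstein bound; they are proportional to F and to F^2, so that \<open>d\<close> is F
        times the claimed relative error.\<close>
      define R where "R = F / real b"
      define V where "V = 3 / (8 * real b) * F\<^sup>2"
      define d where "d = sqrt (2 * V * \<Lambda>) + 2 * R * \<Lambda> / 3"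
      have star: "0 \<le> ell_star n k" using k by (simp add: ell_star_def)
      have \<Lambda>: "1 \<le> \<Lambda>" unfolding \<Lambda>_def using \<delta> by (rule ln_three_div_ge_1)
      have L: "\<Lambda> \<le> L" unfolding L_def \<Lambda>_def using star \<delta> by (intro ln_le_log_term) auto
      note b_bounds = b_param_bounds[OF k(3)]
      have "0 < real_of_int (b_param n k \<delta>)" using b_bounds(3) k(3) L \<Lambda> unfolding L_def by linarith
      then have b: "0 < b" "real b = real_of_int (b_param n k \<delta>)" by (auto simp: b_def)
      have R: "0 < R" using assms(5) b by (simp add: R_def)
      have V: "0 < V" using assms(5) b by (simp add: V_def)
      have dF: "d = F * error_bound n k \<delta>"
      proof -
        have "2 * V * \<Lambda> = F\<^sup>2 * (3 * \<Lambda> / (4 * real b))" by (simp add: V_def)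
        then have "sqrt (2 * V * \<Lambda>) = F * sqrt (3 * \<Lambda> / (4 * real b))"
          using assms(5) by (simp only: real_sqrt_mult) simp
        then show ?thesis
          unfolding d_def error_bound_def R_def \<Lambda>_def b(2) by (simp add: algebra_simps)
      qed
      have a_dec: "a (Suc i) \<le> a i" if "1 \<le> i" "i < n" for i
        using len xs(3) that sorted_wrt_nth_less[of _ xs "i - 1" i] by (simp add: a_def elt_def)
      have a_nonneg: "0 \<le> a i" if "1 \<le> i" "i \<le> n" for i
        using that len by (auto simp: a_def intro!: f elt_in_set)
      have ia: "real i * a i \<le> F" if "1 \<le> i" "i \<le> n" for i
      proof -
        have "real i * a i \<le> (\<Sum>j=1..i. a j)" using that a_dec by (intro mult_le_sum_if_antimono[of n]) auto
        also have "\<dots> \<le> (\<Sum>j=1..n. a j)" using that a_nonneg by (intro sum_mono2) auto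
        finally show ?thesis by (simp add: F a_def)
      qed
      have stepR: "a i * dyadic_step b i \<le> R" if "1 \<le> i" "i \<le> n" "1 < dyadic_step b i" for i
      proof -
        have "real b * dyadic_step b i * a i \<le> real i * a i"
          using mult_dyadic_step_less[OF that(3)] a_nonneg that by (intro mult_right_mono) auto
        then show ?thesis using ia[OF that(1,2)] b(1) by (simp add: R_def field_simps)
      qed
      have tail: "measure_pmf.prob ?M {lev. d < \<bar>\<Sum>i=1..length xs. clipped_error (dyadic_step b) k f xs lev i\<bar>}
          \<le> 2 * exp (- \<Lambda>)"
        unfolding d_def
      proof (rule clipped_error_tail)
        fix i assume "1 \<le> i" "i \<le> length xs"
        then have i: "1 \<le> i" "i \<le> n" using len by auto
        show "f (elt xs i) * (dyadic_step b i - 1) \<le> R"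
        proof (cases "1 < dyadic_step b i")
          case True
          then show ?thesis using stepR[OF i True] a_nonneg[OF i] by (simp add: a_def algebra_simps)
        next
          \<comment> \<open>Here the object's value itself may exceed \<open>R\<close>, but the
            factor \<open>dyadic_step b i - 1\<close> vanishes.\<close>
          case False
          then have "dyadic_step b i = 1" using dyadic_step_ge_1[of b i] by simp
          then show ?thesis using R by simp
        qed
        show "f (elt xs i) \<le> R" if "1 < dyadic_step b i"
        proof -
          have "a i * 1 \<le> a i * dyadic_step b i" using a_nonneg[OF i] that by (intro mult_left_mono) auto
          then show ?thesis using stepR[OF i that] by (simp add: a_def)
        qed
      next
        show "(\<Sum>i=1..length xs. (f (elt xs i))\<^sup>2 * (dyadic_step b i - 1)) \<le> V"
          using sum_squares_weight_le[of n a "\<lambda>i. dyadic_step b i - 1" "3 / (8 * real b)"]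
            a_dec a_nonneg sum_dyadic_step_le[OF b(1)] len by (simp add: a_def V_def F)
      qed (use xs(2) f V R \<Lambda> dyadic_step_ge_1 in auto)
      have small: "measure_pmf.prob ?M {lev. \<exists>i\<in>{1..length xs}. \<not> 1 \<le> incl_prob k xs lev i * dyadic_step b i}
          \<le> real (Suc K) * exp (- L)"
      proof (rule prob_incl_prob_small)
        have "log 2 (real n / real k) < real_of_int (ell_star n k) + 1"
          unfolding ell_star_def by linarith
        then have "real n / real k < 2 powr (real_of_int (ell_star n k) + 1)"
          using k by (simp add: log_less_iff)
        also have "\<dots> = 2 ^ K / 2"
        proof -
          have "real_of_int (ell_star n k) + 1 = real K - 1" using star by (simp add: K_def)
          then show ?thesis by (simp only:) (simp add: powr_diff powr_realpow)
        qed
        finally have "real (length xs) / 2 ^ K \<le> real k / 2" using k len by (simp add: field_simps)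
        also have "real k / 2 \<le> real k - sqrt (2 * real k * L)" using b_bounds(1) unfolding L_def by linarith
        finally show "real (length xs) / 2 ^ K \<le> real k - sqrt (2 * real k * L)" .
      qed (use xs(2) b b_bounds L \<Lambda> k in \<open>auto simp: L_def\<close>)
      have "{lev. \<not> \<bar>estimator k f xs lev - F\<bar> / F \<le> error_bound n k \<delta>}
          \<subseteq> {lev. \<exists>i\<in>{1..length xs}. \<not> 1 \<le> incl_prob k xs lev i * dyadic_step b i}
          \<union> {lev. d < \<bar>\<Sum>i=1..length xs. clipped_error (dyadic_step b) k f xs lev i\<bar>}"
      proof
        fix lev assume lev: "lev \<in> {lev. \<not> \<bar>estimator k f xs lev - F\<bar> / F \<le> error_bound n k \<delta>}"
        \<comment> \<open>When every inclusion probability meets its bound, no difference is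
          suppressed and the sum is the true error.\<close>
        have eq: "estimator k f xs lev - F = (\<Sum>i=1..length xs. clipped_error (dyadic_step b) k f xs lev i)"
          if "\<forall>i\<in>{1..length xs}. 1 \<le> incl_prob k xs lev i * dyadic_step b i"
          unfolding estimator_def F len sum_subtractf[symmetric]
          using that len by (intro sum.cong) (auto simp: clipped_error_def algebra_simps)
        have "d < \<bar>estimator k f xs lev - F\<bar>"
          using lev assms(5) by (simp add: dF field_simps)
        then show "lev \<in> {lev. \<exists>i\<in>{1..length xs}. \<not> 1 \<le> incl_prob k xs lev i * dyadic_step b i}
          \<union> {lev. d < \<bar>\<Sum>i=1..length xs. clipped_error (dyadic_step b) k f xs lev i\<bar>}"
          by (cases "\<forall>i\<in>{1..length xs}. 1 \<le> incl_prob k xs lev i * dyadic_step b i") (auto simp: eq)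
      qed
      then have "measure_pmf.prob ?M {lev. \<not> \<bar>estimator k f xs lev - F\<bar> / F \<le> error_bound n k \<delta>}
          \<le> measure_pmf.prob ?M ({lev. \<exists>i\<in>{1..length xs}. \<not> 1 \<le> incl_prob k xs lev i * dyadic_step b i}
          \<union> {lev. d < \<bar>\<Sum>i=1..length xs. clipped_error (dyadic_step b) k f xs lev i\<bar>})"
        by (intro measure_pmf.finite_measure_mono) auto
      also have "\<dots> \<le> real (Suc K) * exp (- L) + 2 * exp (- \<Lambda>)"
        by (rule order_trans[OF measure_Un_le add_mono[OF small tail]]) auto
      \<comment> \<open>The definition of \<open>log_term\<close> makes each of the
        \<open>Suc K\<close> Chernoff events cost an equal share of \<delta> / 3.\<close>
      also have "real (Suc K) * exp (- L) = \<delta> / 3"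
      proof -
        have "real (Suc K) = real_of_int (ell_star n k) + 3" using star by (simp add: K_def)
        moreover have "exp L = 3 * (real_of_int (ell_star n k) + 3) / \<delta>"
          unfolding L_def log_term_def using star \<delta> by (intro exp_ln divide_pos_pos) auto
        ultimately show ?thesis using star \<delta> by (simp add: exp_minus field_simps)
      qed
      also have "\<delta> / 3 + 2 * exp (- \<Lambda>) = \<delta>" using \<delta> by (simp add: \<Lambda>_def exp_minus)
      finally have "measure_pmf.prob ?M {lev. \<not> \<bar>estimator k f xs lev - F\<bar> / F \<le> error_bound n k \<delta>} \<le> \<delta>" .
      moreover have "measure_pmf.prob ?M {lev. \<not> \<bar>estimator k f xs lev - F\<bar> / F \<le> error_bound n k \<delta>}
          = 1 - measure_pmf.prob ?M {lev. \<bar>estimator k f xs lev - F\<bar> / F \<le> error_bound n k \<delta>}"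
        by (subst measure_pmf.prob_compl[symmetric]) (auto intro!: arg_cong[where f = "measure_pmf.prob ?M"])
      ultimately show ?thesis by linarith
    qed
    then show "1 - \<delta> \<le> measure_pmf.prob (Pi_pmf X 0 (\<lambda>_. level_pmf))
        {lev. \<bar>estimator k f xs lev - F\<bar> / F \<le> error_bound n k \<delta>}"
      by (simp only: xs(1))
  qed
qed (use error_bound_bigo in blast)

end
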